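(* Let $X$ be a geodesic metric space (with metric $d$) with a given basepoint $p$. Suppose a group $G$ acts on $X$ isometrically and co-boundedly. Then there exist constants $K>0$ and $0<\epsilon_0\le1$ such that for any $g\in G$ with $d(p,pg)\ge K$ there exists $x\in G$ such that: (1) $0<d(p,px)\le K$, and (2) $\epsilon_0\, d(p,px)+d(px,pg)\le d(p,pg)$.
   Context: Actions are right actions. $X$ is geodesic if for any two points of $X$ there is an isometric embedding of a closed real interval into $X$ taking the endpoints to the two given points. The action is co-bounded if there is a closed ball in $X$ whose $G$-translates cover $X$. *)

theory Defs
  imports "HOL-Analysis.Abstract_Metric_Spaces" "HOL-Algebra.Group"
begin

definition (in Metric_space) geodesic :: bool where
  "geodesic \<longleftrightarrow>
     (\<forall>x\<in>M. \<forall>y\<in>M. \<exists>a b \<gamma>. a \<le> b \<and> \<gamma> \<in> {a..b} \<rightarrow> M \<and>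
        (\<forall>s\<in>{a..b}. \<forall>t\<in>{a..b}. d (\<gamma> s) (\<gamma> t) = \<bar>s - t\<bar>) \<and>
        \<gamma> a = x \<and> \<gamma> b = y)"

(* The library's group_action is a left action; here act x g is the point x g. *)
locale right_action = group G for G (structure) +
  fixes X :: "'x set" and act :: "'x \<Rightarrow> 'g \<Rightarrow> 'x"
  constrains G :: "('g, 'm) monoid_scheme"
  assumes act_closed: "\<lbrakk>x \<in> X; g \<in> carrier G\<rbrakk> \<Longrightarrow> act x g \<in> X"
    and act_one: "x \<in> X \<Longrightarrow> act x \<one> = x"
    and act_mult: "\<lbrakk>x \<in> X; g \<in> carrier G; h \<in> carrier G\<rbrakk> \<Longrightarrow> act x (g \<otimes> h) = act (act x g) h"

locale isometric_right_action = Metric_space X d + right_action G X act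
  for G (structure) and X d act +
  assumes act_isometric:
    "\<lbrakk>x \<in> X; y \<in> X; g \<in> carrier G\<rbrakk> \<Longrightarrow> d (act x g) (act y g) = d x y"
begin

definition cobounded :: bool where
  "cobounded \<longleftrightarrow> (\<exists>c\<in>X. \<exists>r. (\<Union>g\<in>carrier G. (\<lambda>x. act x g) ` mcball c r) = X)"

end

end

theory Submission
  imports Defs
begin

text \<open>
  Co-boundedness makes the orbit of the basepoint \<open>R\<close>-dense for some \<open>R > 0\<close>. On a geodesic from
  \<open>p\<close> to \<open>pg\<close>, the point \<open>q\<close> at distance \<open>2R\<close> from \<open>p\<close> makes full progress towards \<open>pg\<close>, and
  some orbit point \<open>px\<close> lies within \<open>R\<close> of it. Replacing \<open>q\<close> by \<open>px\<close> costs at most \<open>R\<close> in each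
  distance: \<open>d(p,px)\<close> lies in \<open>[R, 3R]\<close>, and \<open>px\<close> is still at least \<open>R\<close> closer to \<open>pg\<close> than \<open>p\<close>
  is. A third of \<open>d(p,px)\<close> is at most this gain, so \<open>K = 3R\<close> and \<open>\<epsilon>\<^sub>0 = 1/3\<close> work.
\<close>

text \<open>
  Cutting a geodesic at time \<open>t\<close> splits its length exactly, so the triangle inequality is an
  equality there.
\<close>

lemma (in Metric_space) geodesic_point_at_distance:
  assumes "geodesic" "x \<in> M" "y \<in> M" "0 \<le> t" "t \<le> d x y"
  obtains q where "q \<in> M" "d x q = t" "d q y = d x y - t"
proof -
  obtain a b \<gamma> where ab: "a \<le> b" "\<gamma> \<in> {a..b} \<rightarrow> M"
      and iso: "\<And>u v. u \<in> {a..b} \<Longrightarrow> v \<in> {a..b} \<Longrightarrow> d (\<gamma> u) (\<gamma> v) = \<bar>u - v\<bar>"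
      and ends: "\<gamma> a = x" "\<gamma> b = y"
    using assms(1-3) unfolding geodesic_def by meson
  have len: "d x y = b - a"
    using iso[of a b] ab(1) ends by simp
  have inside: "a + t \<in> {a..b}"
    using assms(4,5) len by simp
  show thesis
  proof (rule that[of "\<gamma> (a + t)"])
    show "\<gamma> (a + t) \<in> M" using ab(2) inside by blast
    show "d x (\<gamma> (a + t)) = t" using iso[of a "a + t"] inside ab(1) ends assms(4) by simp
    show "d (\<gamma> (a + t)) y = d x y - t" using iso[of "a + t" b] inside ab(1) ends len by simp
  qed
qed

text \<open>
  If balls of radius \<open>r\<close> about the orbit of a centre \<open>c\<close> cover the space, so do balls of radius
  \<open>r + d(c,p)\<close> about the orbit of \<open>p\<close>, because corresponding points of the two orbits always have
  distance \<open>d(c,p)\<close>.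
\<close>

lemma (in isometric_right_action) cobounded_orbit_dense:
  assumes "cobounded" "p \<in> X"
  obtains R where "R > 0" "\<And>q. q \<in> X \<Longrightarrow> \<exists>x\<in>carrier G. d q (act p x) \<le> R"
proof -
  obtain c r where c: "c \<in> X"
      and cover: "(\<Union>g\<in>carrier G. (\<lambda>x. act x g) ` mcball c r) = X"
    using assms(1) unfolding cobounded_def by blast
  show thesis
  proof (rule that[of "max 1 (r + d c p)"])
    show "max 1 (r + d c p) > 0" by simp
    fix q assume "q \<in> X"
    then obtain g y where g: "g \<in> carrier G" and "y \<in> mcball c r" and q: "q = act y g"
      using cover by blast
    then have y: "y \<in> X" "d c y \<le> r"
      by simp_all
    have "d q (act p g) = d y p"
      using act_isometric[OF y(1) assms(2) g] q by simp
    also have "\<dots> \<le> d c y + d c p"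
      using triangle[OF y(1) c assms(2)] commute[of c y] by simp
    finally have "d q (act p g) \<le> max 1 (r + d c p)"
      using y(2) by linarith
    then show "\<exists>x\<in>carrier G. d q (act p x) \<le> max 1 (r + d c p)"
      using g by blast
  qed
qed

theorem proposition4p1:
  fixes G :: "('g, 'm) monoid_scheme" (structure)
    and X :: "'x set" and d :: "'x \<Rightarrow> 'x \<Rightarrow> real"
    and act :: "'x \<Rightarrow> 'g \<Rightarrow> 'x" and p :: 'x
  assumes "Metric_space X d" and "Metric_space.geodesic X d" and "p \<in> X"
    and "isometric_right_action G X d act"
    and "isometric_right_action.cobounded G X d act"
  shows "\<exists>K \<epsilon>\<^sub>0. K > 0 \<and> 0 < \<epsilon>\<^sub>0 \<and> \<epsilon>\<^sub>0 \<le> 1 \<and>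
    (\<forall>g\<in>carrier G. d p (act p g) \<ge> K \<longrightarrow>
      (\<exists>x\<in>carrier G.
         0 < d p (act p x) \<and> d p (act p x) \<le> K \<and>
         \<epsilon>\<^sub>0 * d p (act p x) + d (act p x) (act p g) \<le> d p (act p g)))"
proof -
  interpret isometric_right_action G X d act by fact
  obtain R where R: "R > 0" and dense: "\<And>q. q \<in> X \<Longrightarrow> \<exists>x\<in>carrier G. d q (act p x) \<le> R"
    using cobounded_orbit_dense[OF assms(5,3)] by blast
  have step: "\<exists>x\<in>carrier G. 0 < d p (act p x) \<and> d p (act p x) \<le> 3 * R \<and>
         1 / 3 * d p (act p x) + d (act p x) (act p g) \<le> d p (act p g)"
    if g: "g \<in> carrier G" and far: "d p (act p g) \<ge> 3 * R" for g
  proof -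
    have pg: "act p g \<in> X"
      using act_closed[OF assms(3) g] .
    obtain q where q: "q \<in> X" "d p q = 2 * R" "d q (act p g) = d p (act p g) - 2 * R"
      using geodesic_point_at_distance[OF assms(2,3) pg, of "2 * R"] R far by auto
    obtain x where x: "x \<in> carrier G" and near: "d q (act p x) \<le> R"
      using dense[OF q(1)] by blast
    have px: "act p x \<in> X"
      using act_closed[OF assms(3) x] .
    have "d p (act p x) \<le> 3 * R"
      using triangle[OF assms(3) q(1) px] q(2) near by linarith
    moreover have "R \<le> d p (act p x)"
      using triangle[OF assms(3) px q(1)] q(2) near commute[of q "act p x"] by linarith
    moreover have "d (act p x) (act p g) \<le> d p (act p g) - R"
      using triangle[OF px q(1) pg] q(3) near commute[of q "act p x"] by linarith
    ultimately show ?thesis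
      using x R by (intro bexI[of _ x]) auto
  qed
  show ?thesis
    by (rule exI[of _ "3 * R"], rule exI[of _ "1 / 3"]) (use R step in simp)
qed

end
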